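(* Let $a$, $b$ and $c$ be complex numbers and let $n$ be a nonnegative integer, such that all terms below are well defined (no Gamma function in a numerator, for $0\le k\le n$, is evaluated at a pole, and $(1+2a-2b)_n\neq 0$). Then $$\sum_{k=0}^{n}\frac{\Gamma(1+k)\,\Gamma(\tfrac32+k)\,\Gamma(\tfrac12-a+b+\tfrac k2)\,\Gamma(a+n+\tfrac k2)\,\Gamma(b-a-\tfrac k2)\,\Gamma(-\tfrac12+a+n-\tfrac k2)}{\Gamma(1+n-k)\,\Gamma(2+n+k)\,\Gamma(\tfrac12+k)\,\Gamma(1+a-c+\tfrac k2)\,\Gamma(\tfrac12-a+b+c+\tfrac k2)\,\Gamma(\tfrac12+a-c-\tfrac k2)\,\Gamma(b+c-a-\tfrac k2)}\,\frac{(-1)^k}{k!}$$ $$=\frac{2\,(\tfrac12+2a-b-c)_n\,(b)_n\,(c)_n}{(1)_n\,(1+2a-2b)_n}\;\frac{\Gamma(2a-1+n)\,\Gamma(2b-2a)}{\Gamma(1+2a-2c+n)\,\Gamma(2b+2c-2a+n)}.$$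
   Context: $(x)_0=1$ and $(x)_n=x(x+1)\cdots(x+n-1)$ for $n\ge 1$ is the shifted factorial. $\Gamma$ is the gamma function (meromorphically continued), with $1/\Gamma$ entire, so $1/\Gamma$ is $0$ at the poles of $\Gamma$. The left-hand side is the value at $z=-1$ of a terminating Fox-Wright function ${}_6\Psi_7$, where in general ${}_p\Psi_q[z]=\sum_{k\ge0}\frac{\prod_{i=1}^p\Gamma(\alpha_i+A_ik)}{\prod_{j=1}^q\Gamma(\beta_j+B_jk)}\frac{z^k}{k!}$; the factor $1/\Gamma(1+n-k)$ makes the series terminate at $k=n$. *)

theory Defs
  imports "HOL-Analysis.Analysis"
begin

end

theory Submission
  imports Defs
begin

text \<open>
  Put \<open>x\<^sub>k = k/2 + 1/4\<close> and \<open>y\<^sub>k = x\<^sub>k\<^sup>2\<close>. Since \<open>y\<^sub>k - y\<^sub>j = (k - j)(k + j + 1)/4\<close>, the factors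
  \<open>(-1)\<^sup>k (2k+1) / ((n-k)! (n+k+1)!)\<close> are, up to a constant, the weights of the divided difference
  at the nodes \<open>y\<^sub>0, \<dots>, y\<^sub>n\<close>, and the remaining Gamma factors pair up as values at \<open>\<plusminus>x\<^sub>k\<close>.
  As a function of \<open>c\<close> the sum is \<open>1 / (\<Gamma>(1+2a-2c+n) \<Gamma>(2b+2c-2a+n))\<close> times a polynomial of degree at
  most \<open>n\<close> in \<open>c(e-c)\<close>, where \<open>e = 1/2+2a-b\<close>. At \<open>c = -m\<close> with \<open>0 \<le> m \<le> n\<close> the Gamma quotients collapse
  and the sum becomes the divided difference of \<open>P(y)/(t-y)\<close> with \<open>deg P \<le> n\<close>, that is
  \<open>P(t) / \<Prod>(t - y\<^sub>j)\<close>; here \<open>P(t) = 0\<close> unless \<open>m = n\<close>. These \<open>n + 1\<close> values determine the polynomial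
  when \<open>a\<close> and \<open>b\<close> are generic, and the general case follows by continuity.
\<close>

subsection \<open>Divided differences\<close>

text \<open>With fewer coefficients than nodes to spare, \<open>P\<close> equals its own Lagrange
  interpolant; dividing that formula at \<open>t\<close> by the nodal product turns each basis
  polynomial into \<open>1 / (t - y k)\<close>.\<close>

lemma sum_partial_fractions_Lagrange:
  fixes y :: "'b \<Rightarrow> 'a :: field" and P :: "'a poly"
  assumes I: "finite I" and inj: "inj_on y I" and deg: "degree P < card I"
    and t: "\<And>k. k \<in> I \<Longrightarrow> t \<noteq> y k"
  shows "(\<Sum>k\<in>I. poly P (y k) / (\<Prod>j\<in>I-{k}. y k - y j) / (t - y k))
           = poly P t / (\<Prod>j\<in>I. t - y j)"
proof -
  define w where "w k = (\<Prod>j\<in>I-{k}. y k - y j)" for k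
  have w0: "w k \<noteq> 0" if "k \<in> I" for k
    using that I inj unfolding w_def by (auto simp: prod_zero_iff inj_on_def)
  \<comment> \<open>\<open>Q\<close> is the Lagrange interpolant of \<open>P\<close> at the nodes
    \<open>y k\<close>.\<close>
  define Q where "Q = (\<Sum>k\<in>I. smult (poly P (y k) / w k) (\<Prod>j\<in>I-{k}. [:- y j, 1:]))"
  have "degree Q \<le> card I - 1"
    unfolding Q_def
  proof (rule degree_sum_le[OF I])
    fix k assume k: "k \<in> I"
    have "degree (\<Prod>j\<in>I-{k}. [:- y j, 1:]) \<le> (\<Sum>j\<in>I-{k}. degree [:- y j, 1:])"
      using degree_prod_sum_le[of "I-{k}" "\<lambda>j. [:- y j, 1:]"] I by (simp add: o_def)
    also have "\<dots> = card I - 1"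
      using k I by simp
    finally show "degree (smult (poly P (y k) / w k) (\<Prod>j\<in>I-{k}. [:- y j, 1:])) \<le> card I - 1"
      using degree_smult_le order.trans by blast
  qed
  with deg have degQ: "degree Q < card I"
    by linarith
  have val: "poly Q x = (\<Sum>k\<in>I. poly P (y k) / w k * (\<Prod>j\<in>I-{k}. x - y j))" for x
    by (simp add: Q_def poly_sum poly_prod)
  have "Q = P"
  proof (rule poly_eqI_degree[of "y ` I"])
    fix x assume "x \<in> y ` I"
    then obtain i where i: "i \<in> I" "x = y i" by auto
    have z: "(\<Prod>j\<in>I-{k}. x - y j) = 0" if "k \<in> I - {i}" for k
      using that i I by (intro prod_zero) auto
    have "poly Q x = poly P (y i) / w i * (\<Prod>j\<in>I-{i}. x - y j)"
      unfolding val using z by (subst sum.remove[OF I i(1)]) (simp del: prod_zero_iff)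
    also have "\<dots> = poly P x"
      using w0[OF i(1)] i by (simp add: w_def)
    finally show "poly Q x = poly P x" .
  qed (use degQ deg inj in \<open>simp_all add: card_image\<close>)
  hence "poly P t / (\<Prod>j\<in>I. t - y j) = poly Q t / (\<Prod>j\<in>I. t - y j)"
    by simp
  also have "\<dots> = (\<Sum>k\<in>I. poly P (y k) / w k * (\<Prod>j\<in>I-{k}. t - y j) / (\<Prod>j\<in>I. t - y j))"
    by (simp add: val sum_divide_distrib)
  also have "\<dots> = (\<Sum>k\<in>I. poly P (y k) / w k / (t - y k))"
  proof (rule sum.cong[OF refl])
    fix k assume k: "k \<in> I"
    have "(\<Prod>j\<in>I-{k}. t - y j) \<noteq> 0"
      using t I by (auto simp: prod_zero_iff)
    thus "poly P (y k) / w k * (\<Prod>j\<in>I-{k}. t - y j) / (\<Prod>j\<in>I. t - y j) =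
            poly P (y k) / w k / (t - y k)"
      unfolding prod.remove[OF I k] by simp
  qed
  finally show ?thesis by (simp add: w_def)
qed

text \<open>After cross-scaling, the two polynomials agree at the \<open>n\<close> common roots and
  also at \<open>z n\<close>, which is one point more than the degree. The division-free form covers
  vanishing values at \<open>z n\<close>.\<close>

lemma smult_eq_if_common_roots:
  fixes F G :: "'a :: field poly"
  assumes "degree F \<le> n" "degree G \<le> n" "inj_on z {..n}"
    and "\<And>m. m < n \<Longrightarrow> poly F (z m) = 0" "\<And>m. m < n \<Longrightarrow> poly G (z m) = 0"
  shows "smult (poly G (z n)) F = smult (poly F (z n)) G"
proof (rule poly_eqI_degree[of "z ` {..n}"])
  fix x assume "x \<in> z ` {..n}"
  then obtain m where "m \<le> n" "x = z m" by auto
  with assms(4,5) show "poly (smult (poly G (z n)) F) x = poly (smult (poly F (z n)) G) x"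
    by (cases "m = n") auto
next
  have "card (z ` {..n}) = Suc n"
    using assms(3) by (simp add: card_image)
  thus "degree (smult (poly G (z n)) F) < card (z ` {..n})"
       "degree (smult (poly F (z n)) G) < card (z ` {..n})"
    using assms(1,2) by (auto intro: le_less_trans[OF degree_smult_le])
qed

section \<open>Polynomials in \<open>c * (u - v - c)\<close>\<close>

text \<open>Since (u+i-c)(v+i+c) = (u+i)(v+i) + c(u-v-c), a product of two Pochhammer symbols with
  opposite shifts by \<open>c\<close> is a polynomial in a quantity that depends on \<open>u\<close>
  and \<open>v\<close> only through \<open>u - v\<close>.\<close>

definition pochhammer_pair :: "'a :: comm_ring_1 \<Rightarrow> 'a \<Rightarrow> nat \<Rightarrow> 'a poly"
  where "pochhammer_pair u v r = (\<Prod>i<r. [:(u + of_nat i) * (v + of_nat i), 1:])"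

lemma degree_pochhammer_pair: "degree (pochhammer_pair u v r) \<le> r"
proof -
  have "degree (pochhammer_pair u v r) \<le> (\<Sum>i<r. degree [:(u + of_nat i) * (v + of_nat i), 1:])"
    using degree_prod_sum_le[of "{..<r}" "\<lambda>i. [:(u + of_nat i) * (v + of_nat i), 1:]"]
    by (simp add: pochhammer_pair_def o_def)
  thus ?thesis by simp
qed

lemma poly_pochhammer_pair:
  "poly (pochhammer_pair u v r) (c * (u - v - c)) = pochhammer (u - c) r * pochhammer (v + c) r"
  by (simp add: pochhammer_pair_def pochhammer_prod poly_prod lessThan_atLeast0 algebra_simps
      flip: prod.distrib)

section \<open>The quadratic nodes and their divided-difference weights\<close>

definition node :: "nat \<Rightarrow> complex"
  where "node k = (of_nat k / 2 + 1/4)\<^sup>2"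

lemma node_diff: "node k - node j = (of_nat k - of_nat j) * (of_nat k + of_nat j + 1) / 4"
  by (simp add: node_def power2_eq_square field_simps)

lemma inj_node: "inj_on node A"
proof (rule inj_onI)
  fix k j assume "node k = node j"
  hence "(of_nat k - of_nat j) * (of_nat (Suc (k + j)) :: complex) = 0"
    using node_diff[of k j] by (simp add: add_ac)
  thus "k = j"
    by (simp del: of_nat_Suc)
qed

text \<open>The factors (k-j)(k+j+1)/4 multiply to k! times (k+1)_k, which is (2k)!. This is the
  base case for the full weight.\<close>

lemma prod_node_diff_below:
  "(\<Prod>j<k. node k - node j) = fact (2 * k) / 4 ^ k"
proof -
  have "(\<Prod>j<k. node k - node j) = (\<Prod>j<k. of_nat (k - j) * of_nat (k + 1 + j) / 4)"
    by (intro prod.cong) (auto simp: node_diff of_nat_diff algebra_simps)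
  also have "\<dots> = (\<Prod>j<k. of_nat (k - j)) * (\<Prod>j<k. of_nat (k + 1 + j)) / 4 ^ k"
    by (simp add: prod_dividef prod.distrib)
  also have "(\<Prod>j<k. of_nat (k - j)) = (fact k :: complex)"
    by (simp add: fact_prod_rev lessThan_atLeast0)
  also have "(\<Prod>j<k. of_nat (k + 1 + j)) = pochhammer (1 + of_nat k :: complex) k"
    by (simp add: pochhammer_prod lessThan_atLeast0 add_ac)
  also have "fact k * pochhammer (1 + of_nat k) k = (fact (2 * k) :: complex)"
    using pochhammer_product'[of "1::complex" k k] by (simp add: pochhammer_fact mult_2)
  finally show ?thesis .
qed

text \<open>Induction on \<open>n\<close> from \<open>n = k\<close>: the new factor, times -4, is
  (n+1-k)(n+k+2), which extends both factorials by one. The factor 2k+1 comes from the base case,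
  where (2k)! has to become (2k+1)!.\<close>

lemma prod_node_diff:
  assumes "k \<le> n"
  shows "(\<Prod>j\<in>{..n}-{k}. node k - node j) * of_nat (2 * k + 1) * (-4) ^ n
           = (-1) ^ k * (fact (n - k) * fact (n + k + 1))"
  using assms
proof (induction n rule: dec_induct)
  case base
  have "{..k} - {k} = {..<k}" by auto
  moreover have "(-4) ^ k = ((-1) ^ k * 4 ^ k :: complex)"
    by (rule power_minus)
  moreover have "fact (k + k + 1) = (of_nat (2 * k + 1) * fact (2 * k) :: complex)"
    using fact_Suc[of "2 * k", where ?'a = complex] by (simp only: mult_2 Suc_eq_plus1)
  ultimately show ?case
    by (simp only: prod_node_diff_below) (simp del: of_nat_add of_nat_Suc fact_Suc)
next
  case (step n)
  have set: "{..Suc n} - {k} = insert (Suc n) ({..n} - {k})"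
    using step by auto
  have ins: "(\<Prod>j\<in>{..Suc n}-{k}. node k - node j) =
      (node k - node (Suc n)) * (\<Prod>j\<in>{..n}-{k}. node k - node j)"
    by (subst set) simp
  have "(\<Prod>j\<in>{..Suc n}-{k}. node k - node j) * of_nat (2 * k + 1) * (-4) ^ Suc n =
          (-4) * (node k - node (Suc n)) * ((\<Prod>j\<in>{..n}-{k}. node k - node j) * of_nat (2 * k + 1) * (-4) ^ n)"
    unfolding ins power_Suc by (simp only: mult_ac)
  also have "\<dots> = (-4) * (node k - node (Suc n)) * ((-1) ^ k * (fact (n - k) * fact (n + k + 1)))"
    by (simp only: step.IH)
  also have "(-4) * (node k - node (Suc n)) = of_nat (Suc n - k) * of_nat (Suc n + k + 1)"
    using step by (simp add: node_diff of_nat_diff field_simps)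
  also have "of_nat (Suc n - k) * of_nat (Suc n + k + 1) * ((-1) ^ k * (fact (n - k) * fact (n + k + 1)))
     = (-1) ^ k * ((of_nat (Suc n - k) * fact (n - k)) * (of_nat (Suc (n + k + 1)) * fact (n + k + 1)) :: complex)"
    by simp
  also have "of_nat (Suc n - k) * fact (n - k) = (fact (Suc n - k) :: complex)"
    using step by (simp add: Suc_diff_le)
  also have "of_nat (Suc (n + k + 1)) * fact (n + k + 1) = (fact (Suc n + k + 1) :: complex)"
    by simp
  finally show ?case .
qed

subsection \<open>Pairs of Gamma values\<close>

text \<open>With x = k/2 + 1/4 the two arguments are z + 1/4 + x and z + 1/4 - x, so the pair is
  symmetric in the sign of x.\<close>

definition Gamma_pair :: "complex \<Rightarrow> nat \<Rightarrow> complex"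
  where "Gamma_pair z k = Gamma (z + of_nat k / 2 + 1/2) * Gamma (z - of_nat k / 2)"

definition rGamma_pair :: "complex \<Rightarrow> nat \<Rightarrow> complex"
  where "rGamma_pair z k = rGamma (z + of_nat k / 2 + 1/2) * rGamma (z - of_nat k / 2)"

text \<open>Each factor, evaluated at x^2, splits as (z+1/4+x+i)(z+1/4-x+i); the product is what a
  Gamma pair gains when \<open>z\<close> moves up by \<open>r\<close>.\<close>

definition shift_poly :: "complex \<Rightarrow> nat \<Rightarrow> complex poly"
  where "shift_poly z r = (\<Prod>i<r. [:(z + of_nat i + 1/4)\<^sup>2, -1:])"

lemma shift_poly_0 [simp]: "shift_poly z 0 = 1"
  by (simp add: shift_poly_def)

lemma degree_shift_poly: "degree (shift_poly z r) \<le> r"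
  using degree_prod_sum_le[of "{..<r}" "\<lambda>i. [:(z + of_nat i + 1/4)\<^sup>2, -1:]"]
  by (simp add: shift_poly_def o_def)

lemma poly_shift_poly_square:
  "poly (shift_poly z r) (x\<^sup>2) = pochhammer (z + 1/4 + x) r * pochhammer (z + 1/4 - x) r"
  by (simp add: shift_poly_def poly_prod pochhammer_prod lessThan_atLeast0 power2_eq_square
      algebra_simps flip: prod.distrib)

text \<open>Both arguments rise by \<open>r\<close>, and the two resulting Pochhammer symbols
  combine into a polynomial in x^2 = \<open>node k\<close>. Quotients of pairs at integer distance
  thus become polynomials in the node.\<close>

lemma rGamma_pair_shift:
  "rGamma_pair z k = poly (shift_poly z r) (node k) * rGamma_pair (z + of_nat r) k"
proof -
  have "rGamma_pair z k = (pochhammer (z + of_nat k / 2 + 1/2) r * rGamma (z + of_nat k / 2 + 1/2 + of_nat r))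
         * (pochhammer (z - of_nat k / 2) r * rGamma (z - of_nat k / 2 + of_nat r))"
    unfolding rGamma_pair_def by (simp flip: pochhammer_rGamma)
  thus ?thesis
    by (simp add: poly_shift_poly_square node_def rGamma_pair_def algebra_simps)
qed

lemma half_shift_notin_Ints:
  fixes z :: complex
  assumes "2 * z \<notin> \<int>"
  shows "z + of_nat k / 2 + 1/2 \<notin> \<int>" "z - of_nat k / 2 \<notin> \<int>"
proof -
  show "z + of_nat k / 2 + 1/2 \<notin> \<int>"
  proof
    assume "z + of_nat k / 2 + 1/2 \<in> \<int>"
    hence "2 * (z + of_nat k / 2 + 1/2) - of_nat k - 1 \<in> \<int>" by (intro Ints_diff Ints_mult) auto
    with assms show False by (simp add: algebra_simps)
  qed
  show "z - of_nat k / 2 \<notin> \<int>"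
  proof
    assume "z - of_nat k / 2 \<in> \<int>"
    hence "2 * (z - of_nat k / 2) + of_nat k \<in> \<int>" by (intro Ints_add Ints_mult) auto
    with assms show False by (simp add: algebra_simps)
  qed
qed

lemma Gamma_pair_mult_rGamma_pair:
  assumes "2 * z \<notin> \<int>"
  shows "Gamma_pair z k * rGamma_pair z k = 1"
proof -
  have "Gamma (z + of_nat k / 2 + 1/2) \<noteq> 0" "Gamma (z - of_nat k / 2) \<noteq> 0"
    using half_shift_notin_Ints[OF assms, of k] nonpos_Ints_Int
    by (auto simp only: Gamma_eq_zero_iff)
  thus ?thesis
    by (simp add: Gamma_pair_def rGamma_pair_def rGamma_inverse_Gamma field_simps)
qed

text \<open>The two arguments are raised to z + n/2 and z + n/2 + 1/2, a pair free of
  \<open>k\<close>. The parity of n - k decides which argument reaches which target, and the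
  \<open>div\<close> expressions cover both cases.\<close>

lemma rGamma_pair_split:
  assumes "k \<le> n"
  shows "rGamma_pair z k = pochhammer (z - of_nat k / 2) ((n + k + 1) div 2)
            * pochhammer (z + of_nat k / 2 + 1/2) ((n - k) div 2)
            * (rGamma (z + of_nat n / 2) * rGamma (z + of_nat n / 2 + 1/2))"
proof -
  have A: "rGamma_pair z k = pochhammer (z - of_nat k / 2) p * pochhammer (z + of_nat k / 2 + 1/2) q
       * (rGamma (z - of_nat k / 2 + of_nat p) * rGamma (z + of_nat k / 2 + 1/2 + of_nat q))" for p q
    unfolding rGamma_pair_def
    by (subst pochhammer_rGamma[of _ q], subst pochhammer_rGamma[of _ p]) (simp add: mult_ac)
  obtain d where n: "n = k + d" using assms le_Suc_ex by blast
  show ?thesis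
  proof (cases "even d")
    case True
    then obtain q where d: "d = 2 * q" by (auto elim: evenE)
    show ?thesis using A[of "k + q" q] by (simp add: n d algebra_simps add_divide_distrib)
  next
    case False
    then obtain q where d: "d = 2 * q + 1" by (auto elim: oddE)
    show ?thesis using A[of "k + q + 1" q] by (simp add: n d algebra_simps add_divide_distrib)
  qed
qed

text \<open>Legendre's formula, valid everywhere: if \<open>z\<close> or \<open>z + 1/2\<close> is a
  pole of Gamma then so is \<open>2 * z\<close>, and both sides vanish.\<close>

lemma rGamma_duplication:
  fixes z :: complex
  shows "rGamma z * rGamma (z + 1/2) * of_real (sqrt pi) = exp ((2 * z - 1) * of_real (ln 2)) * rGamma (2 * z)"
proof (cases "z \<in> \<int>\<^sub>\<le>\<^sub>0 \<or> z + 1/2 \<in> \<int>\<^sub>\<le>\<^sub>0")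
  case True
  have "2 * z \<in> \<int>\<^sub>\<le>\<^sub>0"
    using True
  proof (elim disjE)
    assume "z \<in> \<int>\<^sub>\<le>\<^sub>0"
    thus ?thesis
      using nonpos_Ints_add[of z z] by (simp only: mult_2)
  next
    assume *: "z + 1/2 \<in> \<int>\<^sub>\<le>\<^sub>0"
    have "(-1 :: complex) \<in> \<int>\<^sub>\<le>\<^sub>0" by simp
    hence "z + 1/2 + (z + 1/2) + -1 \<in> \<int>\<^sub>\<le>\<^sub>0"
      by (rule nonpos_Ints_add[OF nonpos_Ints_add[OF * *]])
    moreover have "z + 1/2 + (z + 1/2) + -1 = 2 * z"
      by simp
    ultimately show ?thesis by simp
  qed
  hence "rGamma (2 * z) = 0"
    by (simp only: rGamma_eq_zero_iff)
  moreover have "rGamma z * rGamma (z + 1/2) = 0"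
    using True by (simp only: mult_eq_0_iff rGamma_eq_zero_iff)
  ultimately show ?thesis by (simp only: mult_zero_left mult_zero_right)
next
  case False
  hence *: "Gamma z * Gamma (z + 1/2) = exp ((1 - 2 * z) * of_real (ln 2)) * of_real (sqrt pi) * Gamma (2 * z)"
    by (intro Gamma_legendre_duplication) auto
  have **: "(2 * z - 1) * of_real (ln 2) = - ((1 - 2 * z) * of_real (ln 2))"
    by (simp add: algebra_simps)
  show ?thesis
    unfolding rGamma_inverse_Gamma ** exp_minus inverse_mult_distrib[symmetric] *
    by (simp add: field_simps)
qed

text \<open>The j-th factor is (2w-1-j)(2w+j)/4, so the numerators fill the consecutive run from
  2w-1-n to 2w+n.\<close>

lemma prod_sq_minus_node:
  "(\<Prod>j\<le>n. (w - 1/4)\<^sup>2 - node j) = pochhammer (2 * w - 1 - of_nat n) (2 * n + 2) / 4 ^ (n + 1)"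
proof (induction n)
  case 0
  show ?case
    by (simp add: node_def eval_nat_numeral pochhammer_Suc field_simps)
next
  case (Suc n)
  let ?u = "2 * w - 1 - of_nat n"
  have "pochhammer (u - 1) (Suc (Suc r)) = (u - 1) * (pochhammer u r * (u + of_nat r))"
    for u :: complex and r
    by (subst pochhammer_rec, subst pochhammer_Suc) simp
  moreover have "2 * w - 1 - of_nat (Suc n) = ?u - 1"
    by simp
  moreover have "2 * Suc n + 2 = Suc (Suc (2 * n + 2))"
    by simp
  ultimately have p: "pochhammer (2 * w - 1 - of_nat (Suc n)) (2 * Suc n + 2) =
          (?u - 1) * (pochhammer ?u (2 * n + 2) * (?u + of_nat (2 * n + 2)))"
    by (simp only:)
  have "(\<Prod>j\<le>Suc n. (w - 1/4)\<^sup>2 - node j) =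
     pochhammer ?u (2 * n + 2) / 4 ^ (n + 1) * ((w - 1/4)\<^sup>2 - node (Suc n))"
    by (simp add: Suc.IH)
  also have "(w - 1/4)\<^sup>2 - node (Suc n) = (?u - 1) * (?u + of_nat (2 * n + 2)) / 4"
    by (simp add: node_def power2_eq_square field_simps)
  finally show ?case
    unfolding p by simp
qed

subsection \<open>Evaluation of the sum\<close>

text \<open>This is the sum at c = -m: there the parameters of numerator and denominator pairs
  differ by integers, and the summand becomes a rational function of the node with the single pole
  \<open>t\<close>.\<close>

lemma Gamma_pair_sum_at_negative_int:
  assumes a: "2 * a \<notin> \<int>" and ab: "2 * (b - a) \<notin> \<int>" and m: "m \<le> n"
  shows "(\<Sum>k\<le>n. (-1) ^ k * of_nat (2 * k + 1) / (fact (n - k) * fact (n + k + 1))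
            * (Gamma_pair (b - a) k * Gamma_pair (a + of_nat n - 1/2) k)
            * (rGamma_pair (1/2 + a + of_nat m) k * rGamma_pair (b - of_nat m - a) k))
         = (if m = n then 4 * pochhammer b n * pochhammer (1/2 + 2 * a - b + of_nat n) n
              / pochhammer (2 * a + of_nat n - 1) (2 * n + 2) else 0)"
proof -
  define zB where "zB = a + of_nat n - 1/2"
  \<comment> \<open>The zero of \<open>shift_poly zB 1\<close>, the factor separating the pair at
    \<open>zB\<close> from the pair at \<open>zB + 1\<close>.\<close>
  define t where "t = (zB + 1/4)\<^sup>2"
  \<comment> \<open>The degrees n-m and m add up to at most n, one below the number of
    nodes.\<close>
  define P where "P = shift_poly (1/2 + a + of_nat m) (n - m) * shift_poly (b - of_nat m - a) m"
  have zB: "2 * zB \<notin> \<int>"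
  proof
    assume "2 * zB \<in> \<int>"
    hence "2 * zB - of_nat (2 * n) + 1 \<in> \<int>" by (intro Ints_add Ints_diff) auto
    with a show False by (simp add: zB_def algebra_simps)
  qed
  have degP: "degree P \<le> n"
    using degree_mult_le[of "shift_poly (1/2 + a + of_nat m) (n - m)" "shift_poly (b - of_nat m - a) m"]
      degree_shift_poly[of "1/2 + a + of_nat m" "n - m"] degree_shift_poly[of "b - of_nat m - a" m] m
    unfolding P_def by linarith
  have t: "t \<noteq> node k" for k
  proof
    assume "t = node k"
    moreover have "(zB - of_nat k / 2) * (zB + of_nat k / 2 + 1/2) = t - node k"
      by (simp add: t_def node_def power2_eq_square field_simps)
    ultimately have "zB - of_nat k / 2 = 0 \<or> zB + of_nat k / 2 + 1/2 = 0"
      by (simp only: diff_self mult_eq_0_iff)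
    with half_shift_notin_Ints[OF zB, of k] show False by (metis Ints_0)
  qed
  have summand: "(-1) ^ k * of_nat (2 * k + 1) / (fact (n - k) * fact (n + k + 1))
            * (Gamma_pair (b - a) k * Gamma_pair zB k)
            * (rGamma_pair (1/2 + a + of_nat m) k * rGamma_pair (b - of_nat m - a) k)
        = (poly P (node k) / (\<Prod>j\<in>{..n}-{k}. node k - node j) / (t - node k)) / (-4) ^ n"
    if k: "k \<in> {..n}" for k
  proof -
    let ?W = "\<Prod>j\<in>{..n}-{k}. node k - node j"
    let ?D = "fact (n - k) * fact (n + k + 1) :: complex"
    have W: "?W \<noteq> 0"
      using inj_node[of UNIV] by (auto simp: prod_zero_iff inj_eq)
    have "?W * of_nat (2 * k + 1) * (-4) ^ n = (-1) ^ k * ?D"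
      using prod_node_diff[of k n] k by simp
    hence "(-1) ^ k * (?W * of_nat (2 * k + 1) * (-4) ^ n) = ?D"
      by (simp only: left_minus_one_mult_self)
    hence "(-1) ^ k * of_nat (2 * k + 1) * (?W * (-4) ^ n) = 1 * ?D"
      by (simp only: mult_ac mult_1_left mult_1_right)
    hence 1: "(-1) ^ k * of_nat (2 * k + 1) / ?D = 1 / (?W * (-4) ^ n)"
      using W by (subst frac_eq_eq) (simp_all del: of_nat_Suc of_nat_add fact_Suc)
    have 2: "Gamma_pair (b - a) k * rGamma_pair (b - of_nat m - a) k
         = poly (shift_poly (b - of_nat m - a) m) (node k)"
      using Gamma_pair_mult_rGamma_pair[OF ab, of k] rGamma_pair_shift[of "b - of_nat m - a" k m]
      by (simp add: mult_ac)
    \<comment> \<open>Raising 1/2 + a + m by n-m gives \<open>zB + 1\<close>, one step beyond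
      \<open>zB\<close>; that extra step leaves the denominator \<open>t - node k\<close>.\<close>
    have "rGamma_pair zB k = (t - node k) * rGamma_pair (zB + 1) k"
      using rGamma_pair_shift[of zB k 1] by (simp add: shift_poly_def t_def)
    moreover have "rGamma_pair (1/2 + a + of_nat m) k =
           poly (shift_poly (1/2 + a + of_nat m) (n - m)) (node k) * rGamma_pair (zB + 1) k"
      using rGamma_pair_shift[of "1/2 + a + of_nat m" k "n - m"] m
      by (simp add: zB_def of_nat_diff algebra_simps)
    ultimately have "Gamma_pair zB k * rGamma_pair (1/2 + a + of_nat m) k * (t - node k) =
       poly (shift_poly (1/2 + a + of_nat m) (n - m)) (node k) * (Gamma_pair zB k * rGamma_pair zB k)"
      by simp
    hence 3: "Gamma_pair zB k * rGamma_pair (1/2 + a + of_nat m) k =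
       poly (shift_poly (1/2 + a + of_nat m) (n - m)) (node k) / (t - node k)"
      using t[of k] by (simp add: Gamma_pair_mult_rGamma_pair[OF zB] field_simps)
    have "(Gamma_pair (b - a) k * Gamma_pair zB k)
            * (rGamma_pair (1/2 + a + of_nat m) k * rGamma_pair (b - of_nat m - a) k)
        = (Gamma_pair (b - a) k * rGamma_pair (b - of_nat m - a) k)
            * (Gamma_pair zB k * rGamma_pair (1/2 + a + of_nat m) k)"
      by (simp add: mult_ac)
    thus ?thesis
      unfolding mult.assoc[of "_ / _"] 1 2 3 by (simp add: P_def mult_ac)
  qed
  have "(\<Sum>k\<le>n. (-1) ^ k * of_nat (2 * k + 1) / (fact (n - k) * fact (n + k + 1))
            * (Gamma_pair (b - a) k * Gamma_pair zB k)
            * (rGamma_pair (1/2 + a + of_nat m) k * rGamma_pair (b - of_nat m - a) k))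
      = (\<Sum>k\<le>n. poly P (node k) / (\<Prod>j\<in>{..n}-{k}. node k - node j) / (t - node k)) / (-4) ^ n"
    by (subst sum_divide_distrib, intro sum.cong refl summand)
  also have "(\<Sum>k\<le>n. poly P (node k) / (\<Prod>j\<in>{..n}-{k}. node k - node j) / (t - node k))
       = poly P t / (\<Prod>j\<le>n. t - node j)"
    using degP t by (intro sum_partial_fractions_Lagrange inj_node) auto
  also have "poly P t / (\<Prod>j\<le>n. t - node j) / (-4) ^ n =
     (if m = n then 4 * pochhammer b n * pochhammer (1/2 + 2 * a - b + of_nat n) n
              / pochhammer (2 * a + of_nat n - 1) (2 * n + 2) else 0)"
  proof (cases "m = n")
    case False
    with m have "m < n" by simp
    then obtain r where r: "n - m = Suc r" "n = m + Suc r"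
      by (metis Suc_diff_Suc less_imp_Suc_add add_Suc_right diff_add_inverse)
    \<comment> \<open>The last factor, i = r = n-m-1, has 1/2 + a + m + i = \<open>zB\<close> and
      hence vanishes at \<open>t\<close>.\<close>
    have "poly (shift_poly (1/2 + a + of_nat m) (n - m)) t = 0"
      unfolding shift_poly_def poly_prod r(1)
      by (rule prod_zero) (auto intro!: bexI[of _ r] simp: t_def zB_def r(2) algebra_simps)
    with False show ?thesis by (simp add: P_def)
  next
    case True
    have tw: "t = (a + of_nat n - 1/4)\<^sup>2"
      by (simp add: t_def zB_def)
    \<comment> \<open>Reversing the factors produces (-1)^n, which cancels the sign of (-4)^n; the
      powers of 4 leave the constant 4.\<close>
    have "pochhammer (b - of_nat n - a + 1/4 - (a + of_nat n - 1/4)) n =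
          (-1) ^ n * pochhammer (1/2 + 2 * a - b + of_nat n) n"
      using pochhammer_minus[of "2 * a - b + 2 * of_nat n - 1/2" n] by (simp add: algebra_simps)
    hence "poly P t = pochhammer b n * ((-1) ^ n * pochhammer (1/2 + 2 * a - b + of_nat n) n)"
      using True unfolding P_def tw by (simp add: poly_shift_poly_square)
    moreover have "(\<Prod>j\<le>n. t - node j) = pochhammer (2 * a + of_nat n - 1) (2 * n + 2) / 4 ^ (n + 1)"
      unfolding tw using prod_sq_minus_node[of "a + of_nat n" n] by (simp add: algebra_simps)
    moreover have "(-4) ^ n = ((-1) ^ n * 4 ^ n :: complex)"
      by (rule power_minus)
    ultimately show ?thesis using True by (simp add: mult_ac)
  qed
  finally show ?thesis by (simp add: zB_def)
qed

section \<open>Dependence of the sum on \<open>c\<close>\<close>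

text \<open>The exponential depends only on u + v. It will be applied with u = 1/2 + a - c and v = b
  + c - a, where u + v is free of \<open>c\<close>.\<close>

lemma rGamma_duplication_product:
  fixes u v :: complex
  shows "(rGamma (u + of_nat n / 2) * rGamma (u + of_nat n / 2 + 1/2))
       * (rGamma (v + of_nat n / 2) * rGamma (v + of_nat n / 2 + 1/2)) * of_real pi
     = exp ((2 * (u + v) + 2 * of_nat n - 2) * of_real (ln 2))
       * (rGamma (2 * u + of_nat n) * rGamma (2 * v + of_nat n))"
proof -
  have D: "rGamma (w + of_nat n / 2) * rGamma (w + of_nat n / 2 + 1/2) * of_real (sqrt pi)
        = exp ((2 * w + of_nat n - 1) * of_real (ln 2)) * rGamma (2 * w + of_nat n)" for w :: complex
    using rGamma_duplication[of "w + of_nat n / 2"] by (simp add: algebra_simps)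
  have "of_real pi = (of_real (sqrt pi) * of_real (sqrt pi) :: complex)"
    by (simp flip: of_real_mult)
  moreover have "exp ((2 * (u + v) + 2 * of_nat n - 2) * of_real (ln 2)) =
      exp ((2 * u + of_nat n - 1) * of_real (ln 2)) * exp ((2 * v + of_nat n - 1) * of_real (ln 2 :: real) :: complex)"
    by (simp add: algebra_simps flip: exp_add)
  ultimately show ?thesis
    using arg_cong2[OF D[of u] D[of v], of "(*)"] by (simp only: mult_ac)
qed

text \<open>Both \<open>pochhammer_pair\<close> factors have the same parameter difference 1/2 + 2a
  - b, so both are polynomials in the same quantity; the remaining reciprocal Gammas do not involve
  \<open>k\<close>.\<close>

lemma rGamma_pair_product:
  assumes k: "k \<le> n"
  shows "rGamma_pair (1/2 + a - c) k * rGamma_pair (b + c - a) k =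
     poly (pochhammer_pair (1/2 + a - of_nat k / 2) (b - a - of_nat k / 2) ((n + k + 1) div 2)
         * pochhammer_pair (1 + a + of_nat k / 2) (b - a + of_nat k / 2 + 1/2) ((n - k) div 2))
       (c * (1/2 + 2 * a - b - c))
     * ((rGamma (1/2 + a - c + of_nat n / 2) * rGamma (1/2 + a - c + of_nat n / 2 + 1/2))
       * (rGamma (b + c - a + of_nat n / 2) * rGamma (b + c - a + of_nat n / 2 + 1/2)))"
proof -
  have sub: "1/2 + a - of_nat k / 2 - (b - a - of_nat k / 2) - c = 1/2 + 2 * a - b - c"
       "1 + a + of_nat k / 2 - (b - a + of_nat k / 2 + 1/2) - c = 1/2 + 2 * a - b - c"
    by (simp_all add: field_simps)
  have "poly (pochhammer_pair (1/2 + a - of_nat k / 2) (b - a - of_nat k / 2) ((n + k + 1) div 2))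
          (c * (1/2 + 2 * a - b - c)) =
        pochhammer (1/2 + a - of_nat k / 2 - c) ((n + k + 1) div 2)
        * pochhammer (b - a - of_nat k / 2 + c) ((n + k + 1) div 2)"
    "poly (pochhammer_pair (1 + a + of_nat k / 2) (b - a + of_nat k / 2 + 1/2) ((n - k) div 2))
          (c * (1/2 + 2 * a - b - c)) =
        pochhammer (1 + a + of_nat k / 2 - c) ((n - k) div 2)
        * pochhammer (b - a + of_nat k / 2 + 1/2 + c) ((n - k) div 2)"
    by (simp_all only: sub poly_pochhammer_pair[symmetric])
  moreover have "1/2 + a - c - of_nat k / 2 = 1/2 + a - of_nat k / 2 - c"
    "b + c - a - of_nat k / 2 = b - a - of_nat k / 2 + c"
    "1/2 + a - c + of_nat k / 2 + 1/2 = 1 + a + of_nat k / 2 - c"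
    "b + c - a + of_nat k / 2 + 1/2 = b - a + of_nat k / 2 + 1/2 + c"
    by (simp_all add: field_simps)
  ultimately show ?thesis
    unfolding rGamma_pair_split[OF k] poly_mult by (simp only: mult_ac)
qed

text \<open>The first two conditions keep the Gamma pairs invertible and the prefactor nonzero at c
  = -m; the third makes the interpolation points distinct.\<close>

lemma Gamma_pair_sum_generic:
  assumes a: "2 * a \<notin> \<int>" and ab: "2 * (b - a) \<notin> \<int>" and e: "1/2 + 2 * a - b \<notin> \<int>"
  shows "(\<Sum>k\<le>n. (-1) ^ k * of_nat (2 * k + 1) / (fact (n - k) * fact (n + k + 1))
            * (Gamma_pair (b - a) k * Gamma_pair (a + of_nat n - 1/2) k)
            * (rGamma_pair (1/2 + a - c) k * rGamma_pair (b + c - a) k))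
         = 4 * pochhammer (1/2 + 2 * a - b - c) n * pochhammer b n * pochhammer c n
             / (pochhammer 1 n * pochhammer (1 + 2 * a - 2 * b) n)
           * (Gamma (2 * a - 1 + of_nat n) * Gamma (2 * b - 2 * a))
           * (rGamma (1 + 2 * a - 2 * c + of_nat n) * rGamma (2 * b + 2 * c - 2 * a + of_nat n))"
proof -
  define w where "w k = (-1) ^ k * of_nat (2 * k + 1) / (fact (n - k) * fact (n + k + 1))
            * (Gamma_pair (b - a) k * Gamma_pair (a + of_nat n - 1/2) k)" for k
  define e' where "e' = 1/2 + 2 * a - b"
  define S where "S c = (\<Sum>k\<le>n. w k * (rGamma_pair (1/2 + a - c) k * rGamma_pair (b + c - a) k))" for c
  define H where "H c = (rGamma (1/2 + a - c + of_nat n / 2) * rGamma (1/2 + a - c + of_nat n / 2 + 1/2))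
       * (rGamma (b + c - a + of_nat n / 2) * rGamma (b + c - a + of_nat n / 2 + 1/2))" for c
  define R where "R c = rGamma (1 + 2 * a - 2 * c + of_nat n) * rGamma (2 * b + 2 * c - 2 * a + of_nat n)" for c
  \<comment> \<open>The sum stripped of its common factor \<open>H c\<close>, as a polynomial in
    c(e'-c); \<open>G\<close> is the corresponding polynomial of the closed form, and
    \<open>N m\<close> is the value of c(e'-c) at c = -m.\<close>
  define F where "F = (\<Sum>k\<le>n. smult (w k)
      (pochhammer_pair (1/2 + a - of_nat k / 2) (b - a - of_nat k / 2) ((n + k + 1) div 2)
         * pochhammer_pair (1 + a + of_nat k / 2) (b - a + of_nat k / 2 + 1/2) ((n - k) div 2)))"
  define G where "G = pochhammer_pair e' 0 n"
  define N where "N m = - of_nat m * (e' + of_nat m)" for m :: nat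
  define K where "K = exp ((2 * (1/2 + b) + 2 * of_nat n - 2) * of_real (ln 2) :: complex)"

  have degF: "degree F \<le> n"
    unfolding F_def
  proof (intro degree_sum_le)
    \<comment> \<open>Since n+k and n-k have the same parity, exactly one of the two halves rounds
      and the total is n.\<close>
    fix k assume "k \<in> {..n}"
    hence k: "(n + k + 1) div 2 + (n - k) div 2 = n"
      using le_Suc_ex[of k n] by (auto simp: mult_2[symmetric])
    have "degree (pochhammer_pair (1/2 + a - of_nat k / 2) (b - a - of_nat k / 2) ((n + k + 1) div 2)
         * pochhammer_pair (1 + a + of_nat k / 2) (b - a + of_nat k / 2 + 1/2) ((n - k) div 2))
         \<le> (n + k + 1) div 2 + (n - k) div 2"
      by (intro order.trans[OF degree_mult_le] add_mono degree_pochhammer_pair)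
    with k show "degree (smult (w k)
      (pochhammer_pair (1/2 + a - of_nat k / 2) (b - a - of_nat k / 2) ((n + k + 1) div 2)
         * pochhammer_pair (1 + a + of_nat k / 2) (b - a + of_nat k / 2 + 1/2) ((n - k) div 2))) \<le> n"
      using degree_smult_le order.trans by metis
  qed simp
  have degG: "degree G \<le> n"
    unfolding G_def by (rule degree_pochhammer_pair)
  have S: "S c = H c * poly F (c * (e' - c))" for c
    unfolding S_def F_def poly_sum sum_distrib_left
    by (intro sum.cong refl) (simp add: rGamma_pair_product H_def e'_def)
  have G: "poly G (c * (e' - c)) = pochhammer (e' - c) n * pochhammer c n" for c
    using poly_pochhammer_pair[of e' 0 n c] by (simp add: G_def)
  have H: "H c * of_real pi = K * R c" for c
    using rGamma_duplication_product[of "1/2 + a - c" n "b + c - a"]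
    by (simp add: H_def K_def R_def algebra_simps)
  have K: "K \<noteq> 0"
    by (simp add: K_def)
  have N: "N m = (- of_nat m) * (e' - (- of_nat m))" for m
    by (simp add: N_def)
  have S_neg: "S (- of_nat m) = (if m = n then 4 * pochhammer b n * pochhammer (e' + of_nat n) n
              / pochhammer (2 * a + of_nat n - 1) (2 * n + 2) else 0)" if "m \<le> n" for m
    using Gamma_pair_sum_at_negative_int[OF a ab that] by (simp add: S_def w_def e'_def)
  have R_neg: "R (- of_nat m) \<noteq> 0" for m
  proof -
    have "1 + 2 * a - 2 * (- of_nat m) + of_nat n \<notin> \<int>\<^sub>\<le>\<^sub>0"
    proof
      assume "1 + 2 * a - 2 * (- of_nat m) + of_nat n \<in> \<int>\<^sub>\<le>\<^sub>0"
      hence "1 + 2 * a - 2 * (- of_nat m) + of_nat n - of_nat (1 + 2 * m + n) \<in> \<int>"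
        by (intro Ints_diff nonpos_Ints_Int Ints_of_nat)
      with a show False by simp
    qed
    moreover have "2 * b + 2 * (- of_nat m) - 2 * a + of_nat n \<notin> \<int>\<^sub>\<le>\<^sub>0"
    proof
      assume "2 * b + 2 * (- of_nat m) - 2 * a + of_nat n \<in> \<int>\<^sub>\<le>\<^sub>0"
      hence "2 * b + 2 * (- of_nat m) - 2 * a + of_nat n + of_nat (2 * m) - of_nat n \<in> \<int>"
        by (rule Ints_diff[OF Ints_add[OF nonpos_Ints_Int Ints_of_nat] Ints_of_nat])
      with ab show False by (simp add: algebra_simps)
    qed
    ultimately show ?thesis
      unfolding R_def mult_eq_0_iff rGamma_eq_zero_iff by blast
  qed
  have H_neg: "H (- of_nat m) \<noteq> 0" for m
    using H[of "- of_nat m"] R_neg[of m] K by auto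
  have injN: "inj_on N {..n}"
  proof (rule inj_onI)
    fix i j assume "N i = N j"
    hence "(of_nat i - of_nat j) * (e' + of_nat i + of_nat j) = 0"
      by (simp add: N_def algebra_simps)
    moreover have "e' + of_nat i + of_nat j \<noteq> 0"
    proof
      assume "e' + of_nat i + of_nat j = 0"
      hence "e' = - of_nat (i + j)" by (simp add: add_eq_0_iff2 algebra_simps)
      with e show False unfolding e'_def by simp
    qed
    ultimately show "i = j" by simp
  qed
  \<comment> \<open>\<open>F\<close> and \<open>G\<close> both vanish at \<open>N m\<close> for m <
    n, so they are proportional, with the factor read off at c = -n.\<close>
  have "smult (poly G (N n)) F = smult (poly F (N n)) G"
  proof (rule smult_eq_if_common_roots[OF degF degG injN])
    fix m assume m: "m < n"
    show "poly F (N m) = 0"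
      using S[of "- of_nat m"] S_neg[of m] H_neg[of m] m by (simp add: N)
    show "poly G (N m) = 0"
      unfolding N G using m by (simp add: pochhammer_of_nat_eq_0_iff)
  qed
  hence FG: "poly G (N n) * poly F x = poly F (N n) * poly G x" for x
    by (metis poly_smult)

  \<comment> \<open>The proportionality is multiplied by \<open>H\<close> at both points; passing
    from \<open>H\<close> to \<open>R\<close> brings in the same constant K/pi on each side.\<close>
  have SG: "S c * R (- of_nat n) * poly G (N n) = S (- of_nat n) * R c * poly G (c * (e' - c))"
  proof -
    have "S c * (H (- of_nat n) * of_real pi) * poly G (N n) =
            H c * of_real pi * H (- of_nat n) * (poly G (N n) * poly F (c * (e' - c)))"
      by (simp only: S mult_ac)
    also have "\<dots> = S (- of_nat n) * (H c * of_real pi) * poly G (c * (e' - c))"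
      unfolding FG by (simp only: S N mult_ac)
    finally show ?thesis
      unfolding H using K by (simp add: mult_ac)
  qed
  \<comment> \<open>At c = -n the first Gamma argument is 2a-1+n raised by 2n+2 and the second is
    2b-2a lowered by n, the latter giving (-1)^n after reversal.\<close>
  have R_n: "R (- of_nat n) = rGamma (2 * a - 1 + of_nat n) / pochhammer (2 * a + of_nat n - 1) (2 * n + 2)
      * ((-1) ^ n * pochhammer (1 + 2 * a - 2 * b) n * rGamma (2 * b - 2 * a))" (is "_ = ?r / ?p * ?q")
   and p0: "pochhammer (2 * a + of_nat n - 1) (2 * n + 2) \<noteq> 0"
  proof -
    show p0: "?p \<noteq> 0"
    proof
      assume "?p = 0"
      then obtain k where "2 * a + of_nat n - 1 = - of_nat k"
        by (auto simp: pochhammer_eq_0_iff)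
      hence "2 * a = 1 - of_nat n - of_nat k"
        by (simp add: algebra_simps)
      with a show False by simp
    qed
    have "?r = ?p * rGamma (1 + 2 * a - 2 * (- of_nat n) + of_nat n)"
      using pochhammer_rGamma[of "2 * a - 1 + of_nat n" "2 * n + 2"] by (simp add: algebra_simps)
    moreover have "rGamma (2 * b + 2 * (- of_nat n) - 2 * a + of_nat n) = ?q"
      using pochhammer_rGamma[of "2 * b - 2 * a - of_nat n" n]
        pochhammer_minus'[of "2 * b - 2 * a - 1" n]
      by (simp add: algebra_simps)
    ultimately show "R (- of_nat n) = ?r / ?p * ?q"
      using p0 by (simp add: R_def)
  qed
  \<comment> \<open>All three are factors of \<open>R (- of_nat n)\<close>, which is
    nonzero.\<close>
  have r0: "rGamma (2 * a - 1 + of_nat n) \<noteq> 0" "rGamma (2 * b - 2 * a) \<noteq> 0"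
     "pochhammer (1 + 2 * a - 2 * b) n \<noteq> 0"
    using R_neg[of n] unfolding R_n by auto
  have en: "pochhammer (e' + of_nat n) n \<noteq> 0"
  proof
    assume "pochhammer (e' + of_nat n) n = 0"
    then obtain k where "e' + of_nat n = - of_nat k"
      by (auto simp: pochhammer_eq_0_iff)
    hence "e' = - of_nat k - of_nat n"
      by (simp add: algebra_simps)
    with e show False unfolding e'_def by simp
  qed
  have Gn: "poly G (N n) = (-1) ^ n * fact n * pochhammer (e' + of_nat n) n"
    unfolding N G by (simp add: pochhammer_same)
  have "S c * (?r * (pochhammer (1 + 2 * a - 2 * b) n * rGamma (2 * b - 2 * a))) * fact n
      = 4 * pochhammer b n * R c * (pochhammer (e' - c) n * pochhammer c n)"
  proof -
    \<comment> \<open>This factor appears on both sides and is cancelled at the end; the signs of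
      \<open>R_n\<close> and \<open>Gn\<close> multiply to 1.\<close>
    let ?E = "pochhammer (e' + of_nat n) n / ?p"
    have "S c * (?r * (pochhammer (1 + 2 * a - 2 * b) n * rGamma (2 * b - 2 * a))) * fact n * ?E
        = S c * (?r * (pochhammer (1 + 2 * a - 2 * b) n * rGamma (2 * b - 2 * a))) * fact n * ?E
            * ((-1) ^ n * (-1) ^ n)"
      by simp
    also have "\<dots> = S c * R (- of_nat n) * poly G (N n)"
      unfolding R_n Gn by (simp only: divide_inverse mult_ac)
    also have "\<dots> = (4 * pochhammer b n * R c * (pochhammer (e' - c) n * pochhammer c n)) * ?E"
      unfolding SG G using S_neg[of n] by (simp add: divide_inverse mult_ac)
    finally show ?thesis
      using en p0 by simp
  qed
  hence "S c = 4 * pochhammer (e' - c) n * pochhammer b n * pochhammer c n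
             / (fact n * pochhammer (1 + 2 * a - 2 * b) n)
           * (inverse (rGamma (2 * a - 1 + of_nat n)) * inverse (rGamma (2 * b - 2 * a))) * R c"
    using r0 by (simp add: field_simps)
  thus ?thesis
    by (simp add: S_def w_def e'_def R_def pochhammer_fact rGamma_inverse_Gamma)
qed

section \<open>From generic parameters to the general case\<close>

lemma eventually_affine_notin_Ints:
  fixes p q :: complex
  assumes "q \<noteq> 0"
  shows "\<forall>\<^sub>F t in at 0. p + q * t \<notin> \<int>"
proof -
  have "\<not> p islimpt (\<int> :: complex set)"
    by (rule discrete_imp_not_islimpt[of 1]) (auto elim!: Ints_cases simp: dist_of_int)
  hence "\<forall>\<^sub>F x in at p. x \<notin> \<int>"
    by (simp add: islimpt_iff_eventually)
  moreover have "filterlim (\<lambda>t. p + q * t) (at p) (at 0)"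
    using assms by (intro filterlim_atI tendsto_eq_intros) (auto simp: eventually_at_filter)
  ultimately show ?thesis
    by (rule eventually_compose_filterlim)
qed

lemma tendsto_pochhammer [tendsto_intros]:
  fixes f :: "'b \<Rightarrow> 'a :: real_normed_field"
  assumes "(f \<longlongrightarrow> c) F"
  shows "((\<lambda>t. pochhammer (f t) n) \<longlongrightarrow> pochhammer c n) F"
  by (rule isCont_tendsto_compose[OF isCont_pochhammer assms])

lemma tendsto_Gamma_pair:
  assumes "(f \<longlongrightarrow> z) F" "z + of_nat k / 2 + 1/2 \<notin> \<int>\<^sub>\<le>\<^sub>0" "z - of_nat k / 2 \<notin> \<int>\<^sub>\<le>\<^sub>0"
  shows "((\<lambda>t. Gamma_pair (f t) k) \<longlongrightarrow> Gamma_pair z k) F"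
  unfolding Gamma_pair_def by (intro tendsto_intros assms) auto

lemma tendsto_rGamma [tendsto_intros]:
  assumes "(f \<longlongrightarrow> z) F"
  shows "((\<lambda>t. rGamma (f t)) \<longlongrightarrow> rGamma z) F"
  by (rule isCont_tendsto_compose[OF isCont_rGamma[OF continuous_ident] assms])

lemma tendsto_rGamma_pair [tendsto_intros]:
  assumes "(f \<longlongrightarrow> z) F"
  shows "((\<lambda>t. rGamma_pair (f t) k) \<longlongrightarrow> rGamma_pair z k) F"
  unfolding rGamma_pair_def by (intro tendsto_intros assms) auto

text \<open>Gamma(1+k) cancels k!, and Gamma(3/2+k)/Gamma(1/2+k) = (2k+1)/2 supplies the weight 2k+1
  and the prefactor 1/2; the other factors pair up.\<close>

lemma summand_eq_Gamma_pairs: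
  assumes k: "k \<le> n"
  shows "(Gamma (1 + of_nat k) * Gamma (3/2 + of_nat k)
         * Gamma (1/2 - a + b + of_nat k / 2) * Gamma (a + of_nat n + of_nat k / 2)
         * Gamma (b - a - of_nat k / 2) * Gamma (- 1/2 + a + of_nat n - of_nat k / 2))
        * (rGamma (1 + of_nat n - of_nat k) * rGamma (2 + of_nat n + of_nat k)
         * rGamma (1/2 + of_nat k) * rGamma (1 + a - c + of_nat k / 2)
         * rGamma (1/2 - a + b + c + of_nat k / 2) * rGamma (1/2 + a - c - of_nat k / 2)
         * rGamma (b + c - a - of_nat k / 2))
        * ((- 1) ^ k / fact k)
    = 1/2 * ((-1) ^ k * of_nat (2 * k + 1) / (fact (n - k) * fact (n + k + 1))
            * (Gamma_pair (b - a) k * Gamma_pair (a + of_nat n - 1/2) k)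
            * (rGamma_pair (1/2 + a - c) k * rGamma_pair (b + c - a) k))"
proof -
  have rfact: "rGamma (1 + of_nat m) = inverse (fact m :: complex)" for m
    by (simp add: rGamma_inverse_Gamma Gamma_fact add.commute)
  have "1 + of_nat n - of_nat k = (1 + of_nat (n - k) :: complex)"
       "2 + of_nat n + of_nat k = (1 + of_nat (n + k + 1) :: complex)"
    using k by (simp_all add: of_nat_diff)
  hence 1: "rGamma (1 + of_nat n - of_nat k) = inverse (fact (n - k) :: complex)"
       "rGamma (2 + of_nat n + of_nat k) = inverse (fact (n + k + 1) :: complex)"
    by (simp_all only: rfact)
  have 2: "Gamma (1 + of_nat k) * (1 / fact k) = (1 :: complex)"
    by (simp add: Gamma_fact add.commute)
  have h: "1/2 + of_nat k \<notin> (\<int>\<^sub>\<le>\<^sub>0 :: complex set)"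
  proof
    assume "1/2 + of_nat k \<in> (\<int>\<^sub>\<le>\<^sub>0 :: complex set)"
    then obtain m where m: "1/2 + of_nat k = (of_int m :: complex)" "m \<le> 0"
      by (elim nonpos_Ints_cases)
    have "1/2 + real k = of_int m"
      using arg_cong[OF m(1), of Re] by simp
    with m(2) show False by simp
  qed
  hence "Gamma (1/2 + of_nat k + 1) = (1/2 + of_nat k) * Gamma (1/2 + of_nat k :: complex)"
    by (intro Gamma_plus1) auto
  hence 3: "Gamma (3/2 + of_nat k) * rGamma (1/2 + of_nat k) = (of_nat (2 * k + 1) / 2 :: complex)"
    using h by (simp add: rGamma_inverse_Gamma Gamma_eq_zero_iff field_simps)
  have 4: "Gamma_pair (b - a) k = Gamma (1/2 - a + b + of_nat k / 2) * Gamma (b - a - of_nat k / 2)"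
    "Gamma_pair (a + of_nat n - 1/2) k = Gamma (a + of_nat n + of_nat k / 2) * Gamma (- 1/2 + a + of_nat n - of_nat k / 2)"
    "rGamma_pair (1/2 + a - c) k = rGamma (1 + a - c + of_nat k / 2) * rGamma (1/2 + a - c - of_nat k / 2)"
    "rGamma_pair (b + c - a) k = rGamma (1/2 - a + b + c + of_nat k / 2) * rGamma (b + c - a - of_nat k / 2)"
    unfolding Gamma_pair_def rGamma_pair_def
    by (intro arg_cong2[of _ _ _ _ "(*)"] arg_cong[of _ _ Gamma] arg_cong[of _ _ rGamma];
        simp add: field_simps)+
  have "(Gamma (1 + of_nat k) * Gamma (3/2 + of_nat k)
         * Gamma (1/2 - a + b + of_nat k / 2) * Gamma (a + of_nat n + of_nat k / 2)
         * Gamma (b - a - of_nat k / 2) * Gamma (- 1/2 + a + of_nat n - of_nat k / 2))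
        * (rGamma (1 + of_nat n - of_nat k) * rGamma (2 + of_nat n + of_nat k)
         * rGamma (1/2 + of_nat k) * rGamma (1 + a - c + of_nat k / 2)
         * rGamma (1/2 - a + b + c + of_nat k / 2) * rGamma (1/2 + a - c - of_nat k / 2)
         * rGamma (b + c - a - of_nat k / 2))
        * ((- 1) ^ k / fact k)
     = (Gamma (1 + of_nat k) * (1 / fact k)) * (Gamma (3/2 + of_nat k) * rGamma (1/2 + of_nat k))
        * (rGamma (1 + of_nat n - of_nat k) * rGamma (2 + of_nat n + of_nat k)) * (-1) ^ k
        * (Gamma_pair (b - a) k * Gamma_pair (a + of_nat n - 1/2) k)
        * (rGamma_pair (1/2 + a - c) k * rGamma_pair (b + c - a) k)"
    unfolding 4 by (simp only: divide_inverse mult_ac mult_1_left)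
  thus ?thesis
    unfolding 1 2 3 by (simp only: divide_inverse mult_ac mult_1_left inverse_mult_distrib)
qed

theorem theorem7:
  fixes a b c :: complex and n :: nat
  assumes "\<forall>k\<le>n. 1/2 - a + b + of_nat k / 2 \<notin> \<int>\<^sub>\<le>\<^sub>0"
    and "\<forall>k\<le>n. a + of_nat n + of_nat k / 2 \<notin> \<int>\<^sub>\<le>\<^sub>0"
    and "\<forall>k\<le>n. b - a - of_nat k / 2 \<notin> \<int>\<^sub>\<le>\<^sub>0"
    and "\<forall>k\<le>n. - 1/2 + a + of_nat n - of_nat k / 2 \<notin> \<int>\<^sub>\<le>\<^sub>0"
    and "2 * a - 1 + of_nat n \<notin> \<int>\<^sub>\<le>\<^sub>0"
    and "2 * b - 2 * a \<notin> \<int>\<^sub>\<le>\<^sub>0"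
    and "pochhammer (1 + 2 * a - 2 * b) n \<noteq> 0"
  shows
    "(\<Sum>k=0..n.
        (Gamma (1 + of_nat k) * Gamma (3/2 + of_nat k)
         * Gamma (1/2 - a + b + of_nat k / 2) * Gamma (a + of_nat n + of_nat k / 2)
         * Gamma (b - a - of_nat k / 2) * Gamma (- 1/2 + a + of_nat n - of_nat k / 2))
        * (rGamma (1 + of_nat n - of_nat k) * rGamma (2 + of_nat n + of_nat k)
         * rGamma (1/2 + of_nat k) * rGamma (1 + a - c + of_nat k / 2)
         * rGamma (1/2 - a + b + c + of_nat k / 2) * rGamma (1/2 + a - c - of_nat k / 2)
         * rGamma (b + c - a - of_nat k / 2))
        * ((- 1) ^ k / fact k))
     = 2 * pochhammer (1/2 + 2 * a - b - c) n * pochhammer b n * pochhammer c n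
         / (pochhammer 1 n * pochhammer (1 + 2 * a - 2 * b) n)
       * (Gamma (2 * a - 1 + of_nat n) * Gamma (2 * b - 2 * a))
       * (rGamma (1 + 2 * a - 2 * c + of_nat n) * rGamma (2 * b + 2 * c - 2 * a + of_nat n))"
proof -
  define L where "L a b = (\<Sum>k\<le>n. (-1) ^ k * of_nat (2 * k + 1) / (fact (n - k) * fact (n + k + 1))
            * (Gamma_pair (b - a) k * Gamma_pair (a + of_nat n - 1/2) k)
            * (rGamma_pair (1/2 + a - c) k * rGamma_pair (b + c - a) k))" for a b
  define R where "R a b = 4 * pochhammer (1/2 + 2 * a - b - c) n * pochhammer b n * pochhammer c n
             / (pochhammer 1 n * pochhammer (1 + 2 * a - 2 * b) n)
           * (Gamma (2 * a - 1 + of_nat n) * Gamma (2 * b - 2 * a))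
           * (rGamma (1 + 2 * a - 2 * c + of_nat n) * rGamma (2 * b + 2 * c - 2 * a + of_nat n))" for a b
  \<comment> \<open>The direction \<open>(1, 3)\<close> is chosen to be transversal to all three excluded families of lines.\<close>
  have "\<forall>\<^sub>F t in at 0. 2 * a + 2 * t \<notin> \<int>" "\<forall>\<^sub>F t in at 0. 2 * (b - a) + 4 * t \<notin> \<int>"
       "\<forall>\<^sub>F t in at 0. 1/2 + 2 * a - b + (-1) * t \<notin> \<int>"
    by (rule eventually_affine_notin_Ints; simp)+
  hence eq: "\<forall>\<^sub>F t in at 0. L (a + t) (b + 3 * t) = R (a + t) (b + 3 * t)"
  proof eventually_elim
    case (elim t)
    have "2 * (a + t) = 2 * a + 2 * t" "2 * (b + 3 * t - (a + t)) = 2 * (b - a) + 4 * t"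
         "1/2 + 2 * (a + t) - (b + 3 * t) = 1/2 + 2 * a - b + (-1) * t"
      by (simp_all add: algebra_simps)
    hence "2 * (a + t) \<notin> \<int>" "2 * (b + 3 * t - (a + t)) \<notin> \<int>" "1/2 + 2 * (a + t) - (b + 3 * t) \<notin> \<int>"
      using elim by (simp_all only: not_False_eq_True)
    thus ?case
      unfolding L_def R_def by (rule Gamma_pair_sum_generic)
  qed
  \<comment> \<open>The first and third hypotheses keep both Gamma arguments off the poles, so the
    pair is continuous at t = 0; \<open>G2\<close> uses the second and fourth likewise.\<close>
  have G1: "((\<lambda>t. Gamma_pair (b + 3 * t - (a + t)) k) \<longlongrightarrow> Gamma_pair (b - a) k) (at 0)"
    if "k \<le> n" for k
    using assms(1,3) that by (intro tendsto_Gamma_pair tendsto_eq_intros) (auto simp: algebra_simps)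
  have G2: "((\<lambda>t. Gamma_pair (a + t + of_nat n - 1/2) k) \<longlongrightarrow> Gamma_pair (a + of_nat n - 1/2) k) (at 0)"
    if "k \<le> n" for k
    using assms(2,4) that by (intro tendsto_Gamma_pair tendsto_eq_intros) (auto simp: algebra_simps)
  have a0: "((\<lambda>t. a + t) \<longlongrightarrow> a) (at 0)" and b0: "((\<lambda>t. b + 3 * t) \<longlongrightarrow> b) (at 0)"
    by (auto intro!: tendsto_eq_intros)
  have LL: "((\<lambda>t. L (a + t) (b + 3 * t)) \<longlongrightarrow> L a b) (at 0)"
    unfolding L_def by (intro tendsto_sum tendsto_mult G1 G2 tendsto_intros a0 b0) auto
  \<comment> \<open>The last three hypotheses give continuity of the two Gamma factors and a nonzero
    denominator in the limit.\<close>
  have "((\<lambda>t. R (a + t) (b + 3 * t)) \<longlongrightarrow> R a b) (at 0)"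
    unfolding R_def using assms(5-7)
    by (intro tendsto_mult tendsto_divide tendsto_intros a0 b0) (auto simp: pochhammer_fact[symmetric])
  hence "((\<lambda>t. L (a + t) (b + 3 * t)) \<longlongrightarrow> R a b) (at 0)"
    by (rule Lim_transform_eventually) (use eq in eventually_elim, simp)
  with LL have "L a b = R a b"
    by (intro tendsto_unique[OF _ LL]) auto
  moreover have "(\<Sum>k=0..n.
        (Gamma (1 + of_nat k) * Gamma (3/2 + of_nat k)
         * Gamma (1/2 - a + b + of_nat k / 2) * Gamma (a + of_nat n + of_nat k / 2)
         * Gamma (b - a - of_nat k / 2) * Gamma (- 1/2 + a + of_nat n - of_nat k / 2))
        * (rGamma (1 + of_nat n - of_nat k) * rGamma (2 + of_nat n + of_nat k)
         * rGamma (1/2 + of_nat k) * rGamma (1 + a - c + of_nat k / 2)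
         * rGamma (1/2 - a + b + c + of_nat k / 2) * rGamma (1/2 + a - c - of_nat k / 2)
         * rGamma (b + c - a - of_nat k / 2))
        * ((- 1) ^ k / fact k)) = 1/2 * L a b"
    unfolding L_def sum_distrib_left atLeast0AtMost
    by (intro sum.cong refl summand_eq_Gamma_pairs) simp
  ultimately show ?thesis
    by (simp only: R_def) simp
qed

end
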